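(* Let $\alpha>0$. (1) Let $\{X_1,X_2,\dots\}$ be pairwise uncorrelated random variables satisfying $$\sum_{n=1}^{\infty}\frac{\mathrm{Var}(X_n)}{n^{\alpha}}<\infty .$$ Then for any $\varepsilon>0$, $$\sum_{n=1}^{\infty}n^{1-\alpha}P\left\{\left|\frac{S_n-E(S_n)}{n}\right|\geq \varepsilon\right\}<\infty .$$ (2) If $\{X_1,X_2,\dots\}$ is a sequence of independent random variables satisfying $\sum_{n=1}^{\infty}\frac{\mathrm{Var}(X_n)}{n^{\alpha}}<\infty$, then for any $\varepsilon>0$, $$\sum_{n=1}^{\infty}n^{1-\alpha}P\left\{\max_{1\leq k\leq n}|S_k-E(S_k)|\geq n\varepsilon\right\}<\infty .$$
   Context: All random variables are real-valued and defined on a common probability space $(\Omega,\mathcal{F},P)$; $E$ denotes expectation and $\mathrm{Var}$ denotes variance (the $X_n$ have finite second moments, so that variances and covariances are defined and finite). $S_n=\sum_{k=1}^n X_k$ for $n\ge 1$. Pairwise uncorrelated means $\mathrm{Cov}(X_i,X_j)=0$ for all $i\neq j$. *)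

theory Defs
  imports "HOL-Probability.Probability"
begin

context prob_space
begin

text \<open>Intended for random variables with finite second moment; otherwise the Bochner integral
  may default to 0.\<close>

definition covariance :: "('a \<Rightarrow> real) \<Rightarrow> ('a \<Rightarrow> real) \<Rightarrow> real" where
  "covariance Y Z = expectation (\<lambda>\<omega>. (Y \<omega> - expectation Y) * (Z \<omega> - expectation Z))"

definition pairwise_uncorrelated :: "(nat \<Rightarrow> 'a \<Rightarrow> real) \<Rightarrow> nat set \<Rightarrow> bool" where
  "pairwise_uncorrelated X I \<longleftrightarrow> (\<forall>i\<in>I. \<forall>j\<in>I. i \<noteq> j \<longrightarrow> covariance (X i) (X j) = 0)"

end

text \<open>The sequence is indexed from 1; the value \<open>X 0\<close> is never used.\<close>

definition partial_sum :: "(nat \<Rightarrow> 'a \<Rightarrow> real) \<Rightarrow> nat \<Rightarrow> 'a \<Rightarrow> real" where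
  "partial_sum X n \<omega> = (\<Sum>k=1..n. X k \<omega>)"

end

theory Submission
  imports Defs
begin

text \<open>
  Both tail probabilities are at most \<open>(\<Sum>k\<le>n. Var X\<^sub>k) / (n\<epsilon>)\<^sup>2\<close>: by Chebyshev's inequality in the
  uncorrelated case, and by Kolmogorov's maximal inequality in the independent case. Since
  \<open>n powr (- \<alpha> - 1)\<close> is dominated by a multiple of \<open>n powr - \<alpha> - (n + 1) powr - \<alpha>\<close>, summation by
  parts bounds the weighted sums of these variances by \<open>\<Sum>k. Var X\<^sub>k / k powr \<alpha>\<close>.
  For Kolmogorov's inequality, the walk is frozen as soon as it leaves \<open>(-c, c)\<close>; each step of the
  frozen walk is independent of the past up to a factor determined by the past, so its second moment
  is at most the sum of the variances.
\<close>

section \<open>Power-weighted series of partial sums\<close>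

text \<open>The mean value theorem for \<open>t powr - a\<close> on \<open>[x, x + 1]\<close> gives
  a decrement of the right order; it remains to compare the intermediate point with
  \<open>x\<close>.\<close>

lemma powr_le_powr_diff:
  fixes a x :: real
  assumes "a > 0" "x \<ge> 1"
  shows "x powr (- a - 1) \<le> 2 powr (a + 1) / a * (x powr - a - (x + 1) powr - a)"
proof -
  have "\<exists>z. x < z \<and> z < x + 1 \<and>
      (x + 1) powr - a - x powr - a = (x + 1 - x) * (- a * z powr (- a - 1))"
    using assms by (intro MVT2) (auto intro!: derivative_eq_intros)
  then obtain z where z: "x < z" "z < x + 1"
    "x powr - a - (x + 1) powr - a = a * z powr (- a - 1)"
    by auto
  \<comment> \<open>Since \<open>x \<ge> 1\<close>, the intermediate point satisfies
    \<open>z < x + 1 \<le> 2 * x\<close>; passing to \<open>2 * x\<close> produces the constant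
    \<open>2 powr (a + 1)\<close>.\<close>
  have "x powr (- a - 1) = 2 powr (a + 1) * (2 * x) powr (- a - 1)"
    using assms by (simp add: powr_mult powr_add [symmetric] flip: mult.assoc)
  also have "\<dots> \<le> 2 powr (a + 1) * z powr (- a - 1)"
    using assms z by (intro mult_left_mono powr_mono2') auto
  finally show ?thesis
    using assms by (simp add: z(3))
qed

lemma summation_by_parts:
  fixes a v :: "nat \<Rightarrow> 'a :: comm_ring"
  shows "(\<Sum>n<N. (a n - a (Suc n)) * (\<Sum>k\<le>n. v k)) = (\<Sum>k<N. a k * v k) - a N * (\<Sum>k<N. v k)"
  by (induction N) (simp_all add: lessThan_Suc_atMost [symmetric] algebra_simps)

text \<open>The weight is dominated by \<open>C\<close> times a decrement of \<open>w\<close>, and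
  summation by parts turns sums against these decrements back into sums of
  \<open>w k * v k\<close>.\<close>

lemma summable_powr_partial_sums:
  fixes v :: "nat \<Rightarrow> real"
  assumes a: "a > 0" and v: "\<And>n. v n \<ge> 0"
    and summ: "summable (\<lambda>n. v n / real (Suc n) powr a)"
  shows "summable (\<lambda>n. real (Suc n) powr (- a - 1) * (\<Sum>k\<le>n. v k))"
proof -
  define w where "w = (\<lambda>n. real (Suc n) powr - a)"
  define C where "C = 2 powr (a + 1) / a"
  have C: "C > 0" using a by (simp add: C_def)
  have wv: "w n * v n = v n / real (Suc n) powr a" for n
    by (simp add: w_def powr_minus divide_simps)
  show ?thesis
  proof (rule summableI_nonneg_bounded)
    show "0 \<le> real (Suc n) powr (- a - 1) * (\<Sum>k\<le>n. v k)" for n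
      by (intro mult_nonneg_nonneg sum_nonneg v) auto
    fix N
    have "(\<Sum>n<N. real (Suc n) powr (- a - 1) * (\<Sum>k\<le>n. v k))
        \<le> (\<Sum>n<N. C * (w n - w (Suc n)) * (\<Sum>k\<le>n. v k))"
    proof (intro sum_mono mult_right_mono sum_nonneg v)
      fix n
      show "real (Suc n) powr (- a - 1) \<le> C * (w n - w (Suc n))"
        using powr_le_powr_diff[OF a, of "real (Suc n)"] by (simp add: C_def w_def add_ac)
    qed
    also have "\<dots> = C * (\<Sum>n<N. (w n - w (Suc n)) * (\<Sum>k\<le>n. v k))"
      by (simp add: sum_distrib_left mult.assoc)
    also have "\<dots> = C * ((\<Sum>k<N. w k * v k) - w N * (\<Sum>k<N. v k))"
      by (simp only: summation_by_parts)
    also have "\<dots> \<le> C * (\<Sum>k<N. w k * v k)"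
      using C v by (intro mult_left_mono) (auto simp: w_def intro!: mult_nonneg_nonneg sum_nonneg)
    also have "\<dots> \<le> C * (\<Sum>k. w k * v k)"
      using C v summ unfolding wv by (intro mult_left_mono sum_le_suminf) auto
    finally show "(\<Sum>n<N. real (Suc n) powr (- a - 1) * (\<Sum>k\<le>n. v k)) \<le> C * (\<Sum>k. w k * v k)" .
  qed
qed

text \<open>Common last step of both cases: \<open>p\<close> stands for the tail probabilities,
  bounded as Chebyshev or Kolmogorov provides.\<close>

lemma summable_powr_mult_tail_bound:
  fixes v p :: "nat \<Rightarrow> real"
  assumes "a > 0" "\<And>n. v n \<ge> 0" "summable (\<lambda>n. v n / real (Suc n) powr a)"
    and e: "e > 0" and p: "\<And>n. p n \<ge> 0" "\<And>n. p n \<le> (\<Sum>k\<le>n. v k) / (real (Suc n) * e)\<^sup>2"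
  shows "summable (\<lambda>n. real (Suc n) powr (1 - a) * p n)"
proof (rule summable_comparison_test')
  show "summable (\<lambda>n. real (Suc n) powr (- a - 1) * (\<Sum>k\<le>n. v k) / e\<^sup>2)"
    by (intro summable_divide summable_powr_partial_sums assms)
  fix n
  \<comment> \<open>The split-off square cancels the one in the denominator of the bound on
    \<open>p n\<close>.\<close>
  have "real (Suc n) powr (1 - a) = real (Suc n) powr (- a - 1) * real (Suc n) powr 2"
    unfolding powr_add [symmetric] by simp
  then have eq: "real (Suc n) powr (1 - a) = real (Suc n) powr (- a - 1) * (real (Suc n))\<^sup>2"
    by (simp only: powr_numeral of_nat_0_le_iff)
  have "real (Suc n) powr (1 - a) * p n
      \<le> real (Suc n) powr (1 - a) * ((\<Sum>k\<le>n. v k) / (real (Suc n) * e)\<^sup>2)"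
    by (intro mult_left_mono p) auto
  also have "\<dots> = real (Suc n) powr (- a - 1) * (\<Sum>k\<le>n. v k) / e\<^sup>2"
    unfolding eq using e by (simp add: power_mult_distrib del: of_nat_Suc)
  finally show "norm (real (Suc n) powr (1 - a) * p n)
      \<le> real (Suc n) powr (- a - 1) * (\<Sum>k\<le>n. v k) / e\<^sup>2"
    using p(1)[of n] by simp
qed

section \<open>Square-integrable functions and orthogonal sums\<close>

lemma integrable_mult_of_square_integrable:
  fixes f g :: "'a \<Rightarrow> real"
  assumes [measurable]: "f \<in> borel_measurable M" "g \<in> borel_measurable M"
    and "integrable M (\<lambda>x. (f x)\<^sup>2)" "integrable M (\<lambda>x. (g x)\<^sup>2)"
  shows "integrable M (\<lambda>x. f x * g x)"
proof (rule Bochner_Integration.integrable_bound)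
  show "integrable M (\<lambda>x. (f x)\<^sup>2 + (g x)\<^sup>2)"
    using assms by auto
  have "\<bar>u * w\<bar> \<le> u\<^sup>2 + w\<^sup>2" for u w :: real
  proof -
    have "2 * (\<bar>u\<bar> * \<bar>w\<bar>) \<le> u\<^sup>2 + w\<^sup>2"
      using sum_squares_bound[of "\<bar>u\<bar>" "\<bar>w\<bar>"] by simp
    moreover have "0 \<le> \<bar>u\<bar> * \<bar>w\<bar>" by simp
    ultimately show ?thesis unfolding abs_mult by linarith
  qed
  then show "AE x in M. norm (f x * g x) \<le> norm ((f x)\<^sup>2 + (g x)\<^sup>2)"
    by (intro AE_I2) auto
qed measurable

lemma square_integrable_add:
  fixes f g :: "'a \<Rightarrow> real"
  assumes "f \<in> borel_measurable M" "g \<in> borel_measurable M"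
    and "integrable M (\<lambda>x. (f x)\<^sup>2)" "integrable M (\<lambda>x. (g x)\<^sup>2)"
  shows "integrable M (\<lambda>x. (f x + g x)\<^sup>2)"
  using assms integrable_mult_of_square_integrable[OF assms]
  by (simp add: power2_sum mult.assoc)

lemma square_integrable_sum:
  fixes Y :: "'i \<Rightarrow> 'a \<Rightarrow> real"
  assumes "\<And>i. i \<in> A \<Longrightarrow> Y i \<in> borel_measurable M" "\<And>i. i \<in> A \<Longrightarrow> integrable M (\<lambda>x. (Y i x)\<^sup>2)"
  shows "integrable M (\<lambda>x. (\<Sum>i\<in>A. Y i x)\<^sup>2)"
  using assms
  by (induction A rule: infinite_finite_induct)
     (auto intro!: square_integrable_add borel_measurable_sum)

text \<open>Pythagoras in L2. For centered random variables the cross integrals are covariances, so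
  this gives the variance of an uncorrelated sum.\<close>

lemma integral_square_sum_orthogonal:
  fixes Y :: "'i \<Rightarrow> 'a \<Rightarrow> real"
  assumes "\<And>i. i \<in> A \<Longrightarrow> Y i \<in> borel_measurable M" "\<And>i. i \<in> A \<Longrightarrow> integrable M (\<lambda>x. (Y i x)\<^sup>2)"
    and "\<And>i j. i \<in> A \<Longrightarrow> j \<in> A \<Longrightarrow> i \<noteq> j \<Longrightarrow> (\<integral>x. Y i x * Y j x \<partial>M) = 0"
  shows "(\<integral>x. (\<Sum>i\<in>A. Y i x)\<^sup>2 \<partial>M) = (\<Sum>i\<in>A. \<integral>x. (Y i x)\<^sup>2 \<partial>M)"
  using assms
\<comment> \<open>For infinite \<open>A\<close> both sums take the default value 0.\<close>
proof (induction A rule: infinite_finite_induct)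
  case (insert i A)
  have prod: "integrable M (\<lambda>x. Y i x * Y j x)" if "j \<in> A" for j
    using that insert.prems by (intro integrable_mult_of_square_integrable) auto
  have S: "integrable M (\<lambda>x. (\<Sum>j\<in>A. Y j x)\<^sup>2)"
    using insert.prems by (intro square_integrable_sum) auto
  have "(\<integral>x. (\<Sum>j\<in>A. Y i x * Y j x) \<partial>M) = (\<Sum>j\<in>A. \<integral>x. Y i x * Y j x \<partial>M)"
    using prod by (rule Bochner_Integration.integral_sum)
  also have "\<dots> = 0"
    using insert.prems insert.hyps by (intro sum.neutral) auto
  finally have cross: "(\<integral>x. (\<Sum>j\<in>A. Y i x * Y j x) \<partial>M) = 0" .
  have "(\<integral>x. (\<Sum>j\<in>insert i A. Y j x)\<^sup>2 \<partial>M)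
      = (\<integral>x. (Y i x)\<^sup>2 + (\<Sum>j\<in>A. Y j x)\<^sup>2 + 2 * (\<Sum>j\<in>A. Y i x * Y j x) \<partial>M)"
    using insert.hyps by (simp add: power2_sum sum_distrib_left mult.assoc)
  also have "\<dots> = (\<integral>x. (Y i x)\<^sup>2 \<partial>M) + (\<integral>x. (\<Sum>j\<in>A. Y j x)\<^sup>2 \<partial>M)"
    using S prod insert.prems cross by simp
  finally show ?case
    using insert by simp
qed simp_all

section \<open>The walk frozen on leaving an interval\<close>

text \<open>No stopping time is needed: outside \<open>(-c, c)\<close> every increment is 0, so
  testing the present position suffices. The exit step itself is kept, overshoot included.\<close>

primrec stopped_walk :: "real \<Rightarrow> (nat \<Rightarrow> real) \<Rightarrow> nat \<Rightarrow> real" where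
  "stopped_walk c y 0 = 0"
| "stopped_walk c y (Suc n) =
     stopped_walk c y n + (if \<bar>stopped_walk c y n\<bar> < c then y (Suc n) else 0)"

text \<open>A walk that has left the interval never returns, so being inside at time
  \<open>n\<close> means that no step was suppressed.\<close>

lemma stopped_walk_eq_sum:
  "\<bar>stopped_walk c y n\<bar> < c \<Longrightarrow> stopped_walk c y n = (\<Sum>k=1..n. y k)"
  by (induction n) (auto split: if_splits)

text \<open>This reduces a maximum over all times up to \<open>n\<close> to the position at the
  single time \<open>n\<close>.\<close>

lemma stopped_walk_exceeds:
  assumes "c \<le> \<bar>\<Sum>i=1..k. y i\<bar>" "k \<le> n"
  shows "c \<le> \<bar>stopped_walk c y n\<bar>"
  using \<open>k \<le> n\<close>
proof (induction n)
  case 0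
  then show ?case using assms by simp
next
  case (Suc n)
  show ?case
  proof (cases "\<bar>stopped_walk c y n\<bar> < c")
    case True
    \<comment> \<open>For \<open>k \<le> n\<close> the induction hypothesis would put the walk
      outside already, so the exit happens exactly at \<open>Suc n\<close>.\<close>
    with Suc have "k = Suc n" by (cases "k \<le> n") auto
    then show ?thesis
      using True assms(1) stopped_walk_eq_sum[OF True] by simp
  qed auto
qed

lemma stopped_walk_cong:
  "(\<And>k. 1 \<le> k \<Longrightarrow> k \<le> n \<Longrightarrow> y k = z k) \<Longrightarrow> stopped_walk c y n = stopped_walk c z n"
  by (induction n) auto

lemma borel_measurable_stopped_walk:
  assumes "\<And>k. 1 \<le> k \<Longrightarrow> k \<le> n \<Longrightarrow> (\<lambda>x. Y x k) \<in> borel_measurable M"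
  shows "(\<lambda>x. stopped_walk c (Y x) n) \<in> borel_measurable M"
  using assms
proof (induction n)
  case (Suc n)
  have [measurable]: "(\<lambda>x. stopped_walk c (Y x) n) \<in> borel_measurable M"
    "(\<lambda>x. Y x (Suc n)) \<in> borel_measurable M"
    using Suc by auto
  show ?case by simp
qed simp

section \<open>Kolmogorov's maximal inequality\<close>

context prob_space
begin

text \<open>The two variables are measurable functions of the disjoint blocks \<open>{1..n}\<close>
  and \<open>{Suc n}\<close> of an independent family. The free \<open>g\<close> leaves room for a
  truncation.\<close>

lemma indep_var_stopped_walk:
  assumes indep: "indep_vars (\<lambda>_. borel) Y {1..}" and [measurable]: "g \<in> borel_measurable borel"
  shows "indep_var borel (\<lambda>x. g (stopped_walk c (\<lambda>k. Y k x) n) :: real) borel (Y (Suc n))"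
proof -
  have "indep_var
      borel ((\<lambda>f. g (stopped_walk c f n)) \<circ> (\<lambda>x. restrict (\<lambda>i. Y i x) {1..n}))
      borel ((\<lambda>f. f (Suc n)) \<circ> (\<lambda>x. restrict (\<lambda>i. Y i x) {Suc n}))"
    by (intro indep_var_compose[OF indep_var_restrict[OF indep]]
        measurable_compose[OF borel_measurable_stopped_walk]) auto
  moreover have "stopped_walk c (restrict (\<lambda>i. Y i x) {1..n}) n = stopped_walk c (\<lambda>k. Y k x) n" for x
    by (rule stopped_walk_cong) auto
  ultimately show ?thesis
    by (simp add: comp_def)
qed

text \<open>Each frozen increment \<open>D\<close> is orthogonal to the position \<open>Z\<close>
  before it, and \<open>D\<close> is dominated by the original step. Integrability is carried
  through the induction so that the expectations can be split.\<close>

lemma stopped_walk_second_moment: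
  assumes indep: "indep_vars (\<lambda>_. borel) Y {1..}"
    and sq: "\<And>k. k \<ge> 1 \<Longrightarrow> integrable M (\<lambda>x. (Y k x)\<^sup>2)"
    and mean: "\<And>k. k \<ge> 1 \<Longrightarrow> expectation (Y k) = 0"
  shows "integrable M (\<lambda>x. (stopped_walk c (\<lambda>k. Y k x) n)\<^sup>2) \<and>
    expectation (\<lambda>x. (stopped_walk c (\<lambda>k. Y k x) n)\<^sup>2) \<le> (\<Sum>k=1..n. expectation (\<lambda>x. (Y k x)\<^sup>2))"
proof (induction n)
  case (Suc n)
  have meas: "random_variable borel (Y k)" if "k \<ge> 1" for k
    using indep that by (auto simp: indep_vars_def)
  define Z where "Z = (\<lambda>x. stopped_walk c (\<lambda>k. Y k x) n)"
  define D where "D = (\<lambda>x. if \<bar>Z x\<bar> < c then Y (Suc n) x else 0)"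
  \<comment> \<open>Moves the indicator of not being frozen from the step to the past:
    \<open>Z x * D x = G (Z x) * Y (Suc n) x\<close>, a product of independent factors.\<close>
  define G where "G = (\<lambda>z::real. if \<bar>z\<bar> < c then z else 0)"
  have [measurable]: "G \<in> borel_measurable borel"
    unfolding G_def by measurable
  have Y [measurable]: "random_variable borel (Y (Suc n))"
    by (rule meas) simp
  have Z [measurable]: "random_variable borel Z"
    unfolding Z_def by (rule borel_measurable_stopped_walk) (rule meas)
  have D [measurable]: "random_variable borel D"
    unfolding D_def by measurable
  have Zsq: "integrable M (\<lambda>x. (Z x)\<^sup>2)"
    and IH: "expectation (\<lambda>x. (Z x)\<^sup>2) \<le> (\<Sum>k=1..n. expectation (\<lambda>x. (Y k x)\<^sup>2))"
    using Suc unfolding Z_def by auto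
  have Ysq: "integrable M (\<lambda>x. (Y (Suc n) x)\<^sup>2)"
    by (rule sq) simp
  have Dsq: "integrable M (\<lambda>x. (D x)\<^sup>2)"
    by (rule Bochner_Integration.integrable_bound[OF Ysq]) (auto simp: D_def)
  have ZD: "integrable M (\<lambda>x. Z x * D x)"
    by (rule integrable_mult_of_square_integrable[OF Z D Zsq Dsq])
  have "integrable M (\<lambda>x. G (Z x))"
    by (rule Bochner_Integration.integrable_bound[OF square_integrable_imp_integrable[OF Z Zsq]])
       (auto simp: G_def)
  moreover have "integrable M (Y (Suc n))"
    by (rule square_integrable_imp_integrable[OF Y Ysq])
  moreover have "indep_var borel (\<lambda>x. G (Z x)) borel (Y (Suc n))"
    unfolding Z_def by (rule indep_var_stopped_walk[OF indep]) measurable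
  ultimately have "expectation (\<lambda>x. G (Z x) * Y (Suc n) x) = 0"
    using mean[of "Suc n"] by (subst indep_var_lebesgue_integral) auto
  also have "(\<lambda>x. G (Z x) * Y (Suc n) x) = (\<lambda>x. Z x * D x)"
    by (auto simp: G_def D_def)
  finally have cross: "expectation (\<lambda>x. Z x * D x) = 0" .
  have "expectation (\<lambda>x. (Z x + D x)\<^sup>2) = expectation (\<lambda>x. (Z x)\<^sup>2 + (D x)\<^sup>2 + 2 * (Z x * D x))"
    by (simp add: power2_sum mult.assoc)
  also have "\<dots> = expectation (\<lambda>x. (Z x)\<^sup>2) + expectation (\<lambda>x. (D x)\<^sup>2)"
    using Zsq Dsq ZD cross by simp
  also have "expectation (\<lambda>x. (D x)\<^sup>2) \<le> expectation (\<lambda>x. (Y (Suc n) x)\<^sup>2)"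
    by (rule integral_mono[OF Dsq Ysq]) (auto simp: D_def)
  finally have "expectation (\<lambda>x. (Z x + D x)\<^sup>2) \<le> (\<Sum>k=1..Suc n. expectation (\<lambda>x. (Y k x)\<^sup>2))"
    using IH by simp
  moreover have "integrable M (\<lambda>x. (Z x + D x)\<^sup>2)"
    by (rule square_integrable_add[OF Z D Zsq Dsq])
  moreover have "stopped_walk c (\<lambda>k. Y k x) (Suc n) = Z x + D x" for x
    by (simp add: Z_def D_def)
  ultimately show ?case by presburger
qed simp

theorem Kolmogorov_maximal_inequality:
  fixes Y :: "nat \<Rightarrow> 'a \<Rightarrow> real"
  assumes indep: "indep_vars (\<lambda>_. borel) Y {1..}"
    and sq: "\<And>k. k \<ge> 1 \<Longrightarrow> integrable M (\<lambda>x. (Y k x)\<^sup>2)"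
    and mean: "\<And>k. k \<ge> 1 \<Longrightarrow> expectation (Y k) = 0"
    and c: "c > 0"
  shows "prob {x \<in> space M. \<exists>k\<in>{1..n}. c \<le> \<bar>\<Sum>i=1..k. Y i x\<bar>}
    \<le> (\<Sum>k=1..n. expectation (\<lambda>x. (Y k x)\<^sup>2)) / c\<^sup>2"
proof -
  define Z where "Z = (\<lambda>x. stopped_walk c (\<lambda>k. Y k x) n)"
  have Z [measurable]: "random_variable borel Z"
    using indep unfolding Z_def indep_vars_def by (intro borel_measurable_stopped_walk) auto
  have Zsq: "integrable M (\<lambda>x. (Z x)\<^sup>2)"
    and le: "expectation (\<lambda>x. (Z x)\<^sup>2) \<le> (\<Sum>k=1..n. expectation (\<lambda>x. (Y k x)\<^sup>2))"
    using stopped_walk_second_moment[OF indep sq mean] unfolding Z_def by auto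
  have "prob {x \<in> space M. \<exists>k\<in>{1..n}. c \<le> \<bar>\<Sum>i=1..k. Y i x\<bar>} \<le> prob {x \<in> space M. c \<le> \<bar>Z x\<bar>}"
  proof (intro finite_measure_mono)
    show "{x \<in> space M. c \<le> \<bar>Z x\<bar>} \<in> events"
      by measurable
  qed (auto simp: Z_def intro: stopped_walk_exceeds)
  also have "\<dots> \<le> expectation (\<lambda>x. (Z x)\<^sup>2) / c\<^sup>2"
    by (rule second_moment_method[OF Z Zsq c])
  also have "\<dots> \<le> (\<Sum>k=1..n. expectation (\<lambda>x. (Y k x)\<^sup>2)) / c\<^sup>2"
    by (intro divide_right_mono le) simp
  finally show ?thesis .
qed

end

section \<open>Tail bounds for the centered partial sums\<close>

theorem proposition2p4:
  fixes M :: "'a measure" and X :: "nat \<Rightarrow> 'a \<Rightarrow> real" and \<alpha> :: real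
  assumes "prob_space M"
    and "\<alpha> > 0"
    and "\<And>n. n \<ge> 1 \<Longrightarrow> X n \<in> borel_measurable M"
    and "\<And>n. n \<ge> 1 \<Longrightarrow> integrable M (\<lambda>\<omega>. (X n \<omega>)\<^sup>2)"
    and "summable (\<lambda>n. prob_space.variance M (X (Suc n)) / real (Suc n) powr \<alpha>)"
  shows
    "(prob_space.pairwise_uncorrelated M X {1..} \<longrightarrow>
       (\<forall>\<epsilon>>0. summable (\<lambda>n. real (Suc n) powr (1 - \<alpha>) *
          measure M {\<omega> \<in> space M.
            \<bar>(partial_sum X (Suc n) \<omega> - prob_space.expectation M (partial_sum X (Suc n)))
               / real (Suc n)\<bar> \<ge> \<epsilon>})))
     \<and>
     (prob_space.indep_vars M (\<lambda>_. borel) X {1..} \<longrightarrow>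
       (\<forall>\<epsilon>>0. summable (\<lambda>n. real (Suc n) powr (1 - \<alpha>) *
          measure M {\<omega> \<in> space M.
            Max ((\<lambda>k. \<bar>partial_sum X k \<omega> - prob_space.expectation M (partial_sum X k)\<bar>) ` {1..Suc n})
              \<ge> real (Suc n) * \<epsilon>})))"
proof -
  interpret prob_space M by fact
  define Y where "Y = (\<lambda>k x. X k x - expectation (X k))"
  \<comment> \<open>Shifted by one, since the series lemmas index from 0 while the random variables
    start at 1.\<close>
  define v where "v = (\<lambda>n. variance (X (Suc n)))"
  have X: "integrable M (X k)" if "k \<ge> 1" for k
    using assms(3,4)[OF that] by (rule square_integrable_imp_integrable)
  have Y: "random_variable borel (Y k)" if "k \<ge> 1" for k
    using assms(3)[OF that] unfolding Y_def by measurable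
  have Ysq: "integrable M (\<lambda>x. (Y k x)\<^sup>2)" if "k \<ge> 1" for k
    unfolding Y_def using assms(4)[OF that] X[OF that] by (simp add: power2_diff)
  have mean: "expectation (Y k) = 0" if "k \<ge> 1" for k
    unfolding Y_def using X[OF that] by (simp add: prob_space)
  have S: "partial_sum X n x - expectation (partial_sum X n) = (\<Sum>k=1..n. Y k x)" for n x
    unfolding partial_sum_def Y_def sum_subtractf
    by (subst Bochner_Integration.integral_sum) (auto intro: X)
  have v: "v n \<ge> 0" for n
    unfolding v_def by simp
  \<comment> \<open>By definition the variance of \<open>X k\<close> is the second moment of
    \<open>Y k\<close>; only the index shift remains.\<close>
  have sum_v: "(\<Sum>k=1..Suc n. expectation (\<lambda>x. (Y k x)\<^sup>2)) = (\<Sum>k\<le>n. v k)" for n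
    unfolding v_def Y_def atLeast0AtMost [symmetric] One_nat_def sum.shift_bounds_cl_Suc_ivl ..
  have "summable (\<lambda>n. v n / real (Suc n) powr \<alpha>)"
    unfolding v_def by (rule assms)
  \<comment> \<open>From here each case only needs its tail probability bounded by
    \<open>(\<Sum>k\<le>n. v k) / (real (Suc n) * \<epsilon>)\<^sup>2\<close>.\<close>
  note summable = summable_powr_mult_tail_bound[OF \<open>\<alpha> > 0\<close> v this]
  show ?thesis
  proof (intro conjI impI allI)
    fix \<epsilon> :: real
    assume e: "\<epsilon> > 0" and uncorrelated: "pairwise_uncorrelated X {1..}"
    show "summable (\<lambda>n. real (Suc n) powr (1 - \<alpha>) *
          prob {\<omega> \<in> space M. \<bar>(partial_sum X (Suc n) \<omega> - expectation (partial_sum X (Suc n)))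
               / real (Suc n)\<bar> \<ge> \<epsilon>})"
    proof (rule summable[OF e])
      fix n
      have scale: "\<epsilon> \<le> \<bar>t / real (Suc n)\<bar> \<longleftrightarrow> real (Suc n) * \<epsilon> \<le> \<bar>t\<bar>" for t
        by (simp add: abs_divide pos_le_divide_eq mult.commute del: of_nat_Suc)
      let ?T = "\<lambda>x. \<Sum>k=1..Suc n. Y k x"
      have "prob {x \<in> space M. real (Suc n) * \<epsilon> \<le> \<bar>?T x\<bar>}
          \<le> expectation (\<lambda>x. (?T x)\<^sup>2) / (real (Suc n) * \<epsilon>)\<^sup>2"
        using e by (intro second_moment_method borel_measurable_sum square_integrable_sum Y Ysq) auto
      \<comment> \<open>The cross terms of the centered variables are the covariances, which vanish
        by assumption.\<close>
      also have "expectation (\<lambda>x. (?T x)\<^sup>2) = (\<Sum>k\<le>n. v k)"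
        unfolding sum_v [symmetric]
      proof (intro integral_square_sum_orthogonal Y Ysq)
        show "expectation (\<lambda>x. Y i x * Y j x) = 0"
          if "i \<in> {1..Suc n}" "j \<in> {1..Suc n}" "i \<noteq> j" for i j
          using that uncorrelated by (auto simp: pairwise_uncorrelated_def covariance_def Y_def)
      qed auto
      also have "{x \<in> space M. real (Suc n) * \<epsilon> \<le> \<bar>?T x\<bar>}
          = {x \<in> space M. \<bar>(partial_sum X (Suc n) x - expectation (partial_sum X (Suc n)))
               / real (Suc n)\<bar> \<ge> \<epsilon>}"
        unfolding S scale ..
      finally show "prob {x \<in> space M.
          \<bar>(partial_sum X (Suc n) x - expectation (partial_sum X (Suc n))) / real (Suc n)\<bar> \<ge> \<epsilon>}
          \<le> (\<Sum>k\<le>n. v k) / (real (Suc n) * \<epsilon>)\<^sup>2" .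
    qed simp
  next
    fix \<epsilon> :: real
    assume e: "\<epsilon> > 0" and X_indep: "indep_vars (\<lambda>_. borel) X {1..}"
    \<comment> \<open>Centering applies a Borel map to each variable separately, which preserves
      independence.\<close>
    have indep: "indep_vars (\<lambda>_. borel) Y {1..}"
      unfolding Y_def
      by (rule indep_vars_compose2[OF X_indep, where Y = "\<lambda>k z. z - expectation (X k)"]) measurable
    show "summable (\<lambda>n. real (Suc n) powr (1 - \<alpha>) *
          prob {\<omega> \<in> space M.
            Max ((\<lambda>k. \<bar>partial_sum X k \<omega> - expectation (partial_sum X k)\<bar>) ` {1..Suc n})
              \<ge> real (Suc n) * \<epsilon>})"
    proof (rule summable[OF e])
      fix n
      have "prob {x \<in> space M. \<exists>k\<in>{1..Suc n}. real (Suc n) * \<epsilon> \<le> \<bar>\<Sum>i=1..k. Y i x\<bar>}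
          \<le> (\<Sum>k\<le>n. v k) / (real (Suc n) * \<epsilon>)\<^sup>2"
        unfolding sum_v [symmetric] using e
        by (intro Kolmogorov_maximal_inequality indep Ysq mean) auto
      \<comment> \<open>The maximum of a finite nonempty set reaches the threshold iff one of its
        elements does.\<close>
      then show "prob {x \<in> space M.
            Max ((\<lambda>k. \<bar>partial_sum X k x - expectation (partial_sum X k)\<bar>) ` {1..Suc n})
              \<ge> real (Suc n) * \<epsilon>}
          \<le> (\<Sum>k\<le>n. v k) / (real (Suc n) * \<epsilon>)\<^sup>2"
        unfolding S by (simp add: Max_ge_iff del: of_nat_Suc)
    qed simp
  qed
qed

end
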